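(* Let $\alpha>\beta\ge 0$ and $\eta=\beta/\alpha$. Then the functional $\mathcal{R}_\eta:\ell_2\to[0,+\infty]$, $\mathcal{R}_\eta(x)=\|x\|_{\ell_1}^2-\eta\|x\|_{\ell_2}^2$, is coercive: if $\|x\|_{\ell_2}\to+\infty$, then $\mathcal{R}_\eta(x)\to+\infty$.
   Context: $\ell_2$ is the real Hilbert space of square-summable sequences indexed by $\mathbb{N}$, and $\|x\|_{\ell_1}=\sum_i|x_i|\in[0,+\infty]$ for $x\in\ell_2$. $\mathcal{R}_\eta(x)=+\infty$ when $x\in\ell_2\setminus\ell_1$. *)

theory Defs
  imports "HOL-Analysis.Analysis"
begin

section \<open>The real Hilbert space of square-summable sequences\<close>

typedef ell2 = "{x :: nat \<Rightarrow> real. summable (\<lambda>i. (x i)\<^sup>2)}"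
  morphisms seq Ell2
  by (intro exI[of _ "\<lambda>_. 0"]) simp

setup_lifting type_definition_ell2

lemma summable_seq_power2: "summable (\<lambda>i. (seq x i)\<^sup>2)"
  using seq[of x] by simp

lemma square_summable_mult:
  fixes x y :: "nat \<Rightarrow> real"
  assumes "summable (\<lambda>i. (x i)\<^sup>2)" "summable (\<lambda>i. (y i)\<^sup>2)"
  shows "summable (\<lambda>i. x i * y i)"
proof (rule summable_comparison_test')
  show "summable (\<lambda>i. (x i)\<^sup>2 + (y i)\<^sup>2)"
    using assms by (rule summable_add)
  fix i :: nat
  have "2 * (\<bar>x i\<bar> * \<bar>y i\<bar>) \<le> (x i)\<^sup>2 + (y i)\<^sup>2"
    using sum_squares_bound[of "\<bar>x i\<bar>" "\<bar>y i\<bar>"] by (simp add: mult.assoc)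
  moreover have "0 \<le> \<bar>x i\<bar> * \<bar>y i\<bar>" by simp
  ultimately have "\<bar>x i\<bar> * \<bar>y i\<bar> \<le> (x i)\<^sup>2 + (y i)\<^sup>2" by linarith
  then show "norm (x i * y i) \<le> (x i)\<^sup>2 + (y i)\<^sup>2"
    by (simp add: abs_mult)
qed

lemma square_summable_add:
  fixes x y :: "nat \<Rightarrow> real"
  assumes "summable (\<lambda>i. (x i)\<^sup>2)" "summable (\<lambda>i. (y i)\<^sup>2)"
  shows "summable (\<lambda>i. (x i + y i)\<^sup>2)"
  using summable_add[OF summable_add[OF assms] summable_mult[OF square_summable_mult[OF assms], of 2]]
  by (simp add: power2_sum mult.assoc)

lemma square_summable_scale:
  fixes x :: "nat \<Rightarrow> real"
  assumes "summable (\<lambda>i. (x i)\<^sup>2)"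
  shows "summable (\<lambda>i. (c * x i)\<^sup>2)"
  using summable_mult[OF assms, of "c\<^sup>2"] by (simp add: power_mult_distrib)

lemma summable_seq_mult: "summable (\<lambda>i. seq x i * seq y i)"
  by (intro square_summable_mult summable_seq_power2)

instantiation ell2 :: real_inner
begin

lift_definition zero_ell2 :: ell2 is "\<lambda>_. 0" by simp

lift_definition plus_ell2 :: "ell2 \<Rightarrow> ell2 \<Rightarrow> ell2" is "\<lambda>x y i. x i + y i"
  by (rule square_summable_add)

lift_definition uminus_ell2 :: "ell2 \<Rightarrow> ell2" is "\<lambda>x i. - x i" by simp

lift_definition minus_ell2 :: "ell2 \<Rightarrow> ell2 \<Rightarrow> ell2" is "\<lambda>x y i. x i - y i"
  subgoal for x y using square_summable_add[of x "\<lambda>i. - y i"] by simp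
  done

lift_definition scaleR_ell2 :: "real \<Rightarrow> ell2 \<Rightarrow> ell2" is "\<lambda>c x i. c * x i"
  by (rule square_summable_scale)

definition inner_ell2 :: "ell2 \<Rightarrow> ell2 \<Rightarrow> real"
  where "inner_ell2 x y = (\<Sum>i. seq x i * seq y i)"

definition norm_ell2 :: "ell2 \<Rightarrow> real"
  where "norm_ell2 x = sqrt (\<Sum>i. (seq x i)\<^sup>2)"

definition sgn_ell2 :: "ell2 \<Rightarrow> ell2"
  where "sgn_ell2 x = inverse (norm x) *\<^sub>R x"

definition dist_ell2 :: "ell2 \<Rightarrow> ell2 \<Rightarrow> real"
  where "dist_ell2 x y = norm (x - y)"

definition uniformity_ell2 :: "(ell2 \<times> ell2) filter"
  where "uniformity_ell2 = (INF e\<in>{0<..}. principal {(x, y). dist x y < e})"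

definition open_ell2 :: "ell2 set \<Rightarrow> bool"
  where "open_ell2 U \<longleftrightarrow> (\<forall>x\<in>U. eventually (\<lambda>(x', y). x' = x \<longrightarrow> y \<in> U) uniformity)"

instance
proof
  fix x y z :: ell2 and a b c :: real
  show "x + y + z = x + (y + z)" by transfer (simp add: add.assoc)
  show "x + y = y + x" by transfer (simp add: add.commute)
  show "0 + x = x" by transfer simp
  show "- x + x = 0" by transfer simp
  show "x - y = x + - y" by transfer simp
  show "a *\<^sub>R (x + y) = a *\<^sub>R x + a *\<^sub>R y" by transfer (simp add: distrib_left)
  show "(a + b) *\<^sub>R x = a *\<^sub>R x + b *\<^sub>R x" by transfer (simp add: distrib_right)
  show "a *\<^sub>R b *\<^sub>R x = (a * b) *\<^sub>R x" by transfer (simp add: mult.assoc)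
  show "1 *\<^sub>R x = x" by transfer simp
  show "dist x y = norm (x - y)" by (rule dist_ell2_def)
  show "sgn x = inverse (norm x) *\<^sub>R x" by (rule sgn_ell2_def)
  show "uniformity = (INF e\<in>{0<..}. principal {(x :: ell2, y). dist x y < e})"
    by (rule uniformity_ell2_def)
  show "open U \<longleftrightarrow> (\<forall>x\<in>U. eventually (\<lambda>(x', y). x' = x \<longrightarrow> y \<in> U) uniformity)" for U :: "ell2 set"
    by (rule open_ell2_def)
  show "inner x y = inner y x" by (simp add: inner_ell2_def mult.commute)
  show "inner (x + y) z = inner x z + inner y z"
    by (simp add: inner_ell2_def plus_ell2.rep_eq distrib_right suminf_add summable_seq_mult)
  show "inner (a *\<^sub>R x) y = a * inner x y"
    by (simp add: inner_ell2_def scaleR_ell2.rep_eq mult.assoc suminf_mult summable_seq_mult)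
  show "0 \<le> inner x x"
    unfolding inner_ell2_def by (intro suminf_nonneg summable_seq_mult) simp
  show "inner x x = 0 \<longleftrightarrow> x = 0"
    using suminf_eq_zero_iff[OF summable_seq_mult[of x x]]
    by (auto simp: inner_ell2_def seq_inject[symmetric] zero_ell2.rep_eq)
  show "norm x = sqrt (inner x x)"
    by (simp add: norm_ell2_def inner_ell2_def power2_eq_square)
qed

end

lemma norm_ell2_power2: "(norm x)\<^sup>2 = (\<Sum>i. (seq x i)\<^sup>2)" for x :: ell2
  by (simp add: norm_ell2_def suminf_nonneg summable_seq_power2)

lemma sum_seq_power2_le: "(\<Sum>i<k. (seq x i)\<^sup>2) \<le> (norm x)\<^sup>2" for x :: ell2
  unfolding norm_ell2_power2 by (intro sum_le_suminf summable_seq_power2) auto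

lemma abs_seq_le_norm: "\<bar>seq x i\<bar> \<le> norm x" for x :: ell2
proof (rule power2_le_imp_le)
  have "(seq x i)\<^sup>2 \<le> (\<Sum>j<Suc i. (seq x j)\<^sup>2)"
    by (simp add: sum_nonneg)
  also have "\<dots> \<le> (norm x)\<^sup>2" by (rule sum_seq_power2_le)
  finally show "\<bar>seq x i\<bar>\<^sup>2 \<le> (norm x)\<^sup>2" by simp
qed simp

instance ell2 :: complete_space
proof
  fix X :: "nat \<Rightarrow> ell2"
  assume X: "Cauchy X"
  have "Cauchy (\<lambda>n. seq (X n) i)" for i
  proof (rule metric_CauchyI)
    fix e :: real
    assume "0 < e"
    then obtain M where "\<forall>m\<ge>M. \<forall>n\<ge>M. dist (X m) (X n) < e"
      using X metric_CauchyD by blast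
    moreover have "dist (seq (X m) i) (seq (X n) i) \<le> dist (X m) (X n)" for m n
      using abs_seq_le_norm[of "X m - X n" i]
      by (simp add: dist_real_def dist_norm minus_ell2.rep_eq)
    ultimately show "\<exists>M. \<forall>m\<ge>M. \<forall>n\<ge>M. dist (seq (X m) i) (seq (X n) i) < e"
      by (meson le_less_trans)
  qed
  then have "\<exists>l. (\<lambda>n. seq (X n) i) \<longlonglongrightarrow> l" for i
    by (simp add: Cauchy_convergent_iff convergent_def)
  then obtain l where l: "\<And>i. (\<lambda>n. seq (X n) i) \<longlonglongrightarrow> l i" by metis
  have bound: "\<exists>M. \<forall>m\<ge>M. \<forall>k. (\<Sum>i<k. (seq (X m) i - l i)\<^sup>2) \<le> e\<^sup>2" if "0 < e" for e :: real
  proof -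
    obtain M where M: "\<And>m n. m \<ge> M \<Longrightarrow> n \<ge> M \<Longrightarrow> dist (X m) (X n) < e"
      using X \<open>0 < e\<close> metric_CauchyD by blast
    have "(\<Sum>i<k. (seq (X m) i - l i)\<^sup>2) \<le> e\<^sup>2" if "m \<ge> M" for m k
    proof (rule tendsto_upperbound)
      show "(\<lambda>n. \<Sum>i<k. (seq (X m) i - seq (X n) i)\<^sup>2) \<longlonglongrightarrow> (\<Sum>i<k. (seq (X m) i - l i)\<^sup>2)"
        by (intro tendsto_intros l)
      have "(\<Sum>i<k. (seq (X m) i - seq (X n) i)\<^sup>2) \<le> e\<^sup>2" if "n \<ge> M" for n
      proof -
        have "(\<Sum>i<k. (seq (X m) i - seq (X n) i)\<^sup>2) \<le> (norm (X m - X n))\<^sup>2"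
          using sum_seq_power2_le[where x = "X m - X n" and k = k] by (simp add: minus_ell2.rep_eq)
        also have "\<dots> \<le> e\<^sup>2"
          using M[OF \<open>m \<ge> M\<close> that] by (intro power_mono) (auto simp: dist_norm)
        finally show ?thesis .
      qed
      then show "\<forall>\<^sub>F n in sequentially. (\<Sum>i<k. (seq (X m) i - seq (X n) i)\<^sup>2) \<le> e\<^sup>2"
        by (auto simp: eventually_sequentially)
    qed simp
    then show ?thesis by blast
  qed
  have summ: "summable (\<lambda>i. (seq (X m) i - l i)\<^sup>2)"
    if "\<forall>k. (\<Sum>i<k. (seq (X m) i - l i)\<^sup>2) \<le> e\<^sup>2" for m and e :: real
    using that by (intro summableI_nonneg_bounded[where x = "e\<^sup>2"]) auto
  obtain M where "\<forall>m\<ge>M. \<forall>k. (\<Sum>i<k. (seq (X m) i - l i)\<^sup>2) \<le> 1\<^sup>2"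
    using bound[of 1] by auto
  then have "summable (\<lambda>i. (seq (X M) i - l i)\<^sup>2)" by (intro summ[of _ 1]) auto
  then have "summable (\<lambda>i. (l i - seq (X M) i)\<^sup>2)" by (simp add: power2_commute)
  from square_summable_add[OF this summable_seq_power2[of "X M"]]
  have "summable (\<lambda>i. (l i)\<^sup>2)" by simp
  then have seq_l: "seq (Ell2 l) = l" by (simp add: Ell2_inverse)
  have "X \<longlonglongrightarrow> Ell2 l"
  proof (rule metric_LIMSEQ_I)
    fix e :: real
    assume "0 < e"
    then obtain M where M: "\<forall>m\<ge>M. \<forall>k. (\<Sum>i<k. (seq (X m) i - l i)\<^sup>2) \<le> (e / 2)\<^sup>2"
      using bound[of "e / 2"] by auto
    have "dist (X m) (Ell2 l) < e" if "m \<ge> M" for m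
    proof -
      have le: "\<forall>k. (\<Sum>i<k. (seq (X m) i - l i)\<^sup>2) \<le> (e / 2)\<^sup>2"
        using M that by blast
      have "(norm (X m - Ell2 l))\<^sup>2 \<le> (e / 2)\<^sup>2"
        unfolding norm_ell2_power2 minus_ell2.rep_eq seq_l
        by (rule suminf_le_const[OF summ[OF le]]) (rule le[rule_format])
      then have "norm (X m - Ell2 l) \<le> e / 2"
        by (rule power2_le_imp_le) (use \<open>0 < e\<close> in simp)
      then show ?thesis using \<open>0 < e\<close> by (simp add: dist_norm)
    qed
    then show "\<exists>M. \<forall>m\<ge>M. dist (X m) (Ell2 l) < e" by blast
  qed
  then show "convergent X" by (auto simp: convergent_def)
qed

instance ell2 :: banach ..

section \<open>The functional and coercivity\<close>

text \<open>The series is taken in the extended reals, so the value is \<open>\<infinity>\<close> when the sequence is not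
  absolutely summable.\<close>

definition ell1_norm :: "ell2 \<Rightarrow> ereal"
  where "ell1_norm x = (\<Sum>i. ereal \<bar>seq x i\<bar>)"

definition R_eta :: "real \<Rightarrow> ell2 \<Rightarrow> ereal"
  where "R_eta \<eta> x = (ell1_norm x)\<^sup>2 - ereal (\<eta> * (norm x)\<^sup>2)"

lemma ell1_norm_eq_infinity:
  assumes "\<not> summable (\<lambda>i. \<bar>seq x i\<bar>)"
  shows "ell1_norm x = \<infinity>"
  using assms summable_ereal[of "\<lambda>i. \<bar>seq x i\<bar>"] by (auto simp: ell1_norm_def)

lemma R_eta_eq_infinity:
  assumes "\<not> summable (\<lambda>i. \<bar>seq x i\<bar>)"
  shows "R_eta \<eta> x = \<infinity>"
  using ell1_norm_eq_infinity[OF assms] by (simp add: R_eta_def power2_eq_square)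

lemma R_eta_eq_real:
  assumes "summable (\<lambda>i. \<bar>seq x i\<bar>)"
  shows "R_eta \<eta> x = ereal ((\<Sum>i. \<bar>seq x i\<bar>)\<^sup>2 - \<eta> * (norm x)\<^sup>2)"
  using suminf_ereal'[OF assms] by (simp add: R_eta_def ell1_norm_def)

text \<open>\<open>at_infinity\<close> is the filter of the sets \<open>{x. b \<le> norm x}\<close>, so this is the implication
  \<open>norm x \<longlonglongrightarrow> \<infinity>\<close> implies \<open>F x \<longlonglongrightarrow> \<infinity>\<close>.\<close>

definition coercive :: "('a::real_normed_vector \<Rightarrow> ereal) \<Rightarrow> bool"
  where "coercive F \<longleftrightarrow> (F \<longlongrightarrow> \<infinity>) at_infinity"

end

theory Submission
  imports Defs
begin

text \<open>The inequality \<open>\<parallel>x\<parallel>\<^sub>2 \<le> \<parallel>x\<parallel>\<^sub>1\<close> turns the difference of two norms into a multiple of one of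
  them: \<open>\<parallel>x\<parallel>\<^sub>1\<^sup>2 - \<eta> \<parallel>x\<parallel>\<^sub>2\<^sup>2 \<ge> (1 - \<eta>) \<parallel>x\<parallel>\<^sub>2\<^sup>2\<close>, and outside \<open>\<ell>\<^sub>1\<close> the left-hand side is \<open>\<infinity>\<close>
  (lemma \<open>R_eta_ge_scaled_norm_power2\<close>). As \<open>\<alpha> > \<beta> \<ge> 0\<close>, the
  quotient \<open>\<eta> = \<beta> / \<alpha>\<close> is less than 1, so the factor \<open>1 - \<eta>\<close> is positive. The lower
  bound is then nonnegative, and it tends to infinity with the norm of \<open>x\<close>.\<close>

text \<open>Each entry satisfies \<open>\<bar>x\<^sub>i\<bar> \<le> S\<close> for \<open>S = \<parallel>x\<parallel>\<^sub>1\<close>, hence \<open>x\<^sub>i\<^sup>2 \<le> S \<bar>x\<^sub>i\<bar>\<close>; summing over \<open>i\<close>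
  gives \<open>S\<^sup>2\<close> on the right.\<close>

lemma norm_power2_le_suminf_abs_power2:
  assumes "summable (\<lambda>i. \<bar>seq x i\<bar>)"
  shows "(norm x)\<^sup>2 \<le> (\<Sum>i. \<bar>seq x i\<bar>)\<^sup>2"
proof -
  let ?S = "\<Sum>i. \<bar>seq x i\<bar>"
  have entry: "\<bar>seq x i\<bar> \<le> ?S" for i
    using sum_le_suminf[OF assms, of "{i}"] by simp
  have "(seq x i)\<^sup>2 \<le> ?S * \<bar>seq x i\<bar>" for i
    using mult_right_mono[OF entry[of i], of "\<bar>seq x i\<bar>"] by (simp add: power2_eq_square)
  then have "(norm x)\<^sup>2 \<le> (\<Sum>i. ?S * \<bar>seq x i\<bar>)"
    unfolding norm_ell2_power2
    by (intro suminf_le summable_seq_power2 summable_mult assms)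
  also have "\<dots> = ?S\<^sup>2"
    by (simp add: suminf_mult[OF assms] power2_eq_square)
  finally show ?thesis .
qed

lemma R_eta_ge_scaled_norm_power2: "ereal ((1 - \<eta>) * (norm x)\<^sup>2) \<le> R_eta \<eta> x"
proof (cases "summable (\<lambda>i. \<bar>seq x i\<bar>)")
  case True
  then show ?thesis
    using norm_power2_le_suminf_abs_power2[OF True] by (simp add: R_eta_eq_real algebra_simps)
next
  case False
  then show ?thesis by (simp add: R_eta_eq_infinity)
qed

lemma coercive_R_eta:
  assumes "\<eta> < 1"
  shows "coercive (R_eta \<eta>)"
proof -
  have "filterlim (\<lambda>x::ell2. (1 - \<eta>) * (norm x)\<^sup>2) at_top at_infinity"
    using assms
    by (intro filterlim_tendsto_pos_mult_at_top[OF tendsto_const]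
        filterlim_pow_at_top filterlim_norm_at_top) auto
  then have "((\<lambda>x. ereal ((1 - \<eta>) * (norm x)\<^sup>2)) \<longlongrightarrow> \<infinity>) (at_infinity :: ell2 filter)"
    by (simp only: tendsto_PInfty_eq_at_top)
  then show ?thesis
    unfolding coercive_def
    by (rule tendsto_sandwich[rotated 2, OF _ tendsto_const])
      (simp_all add: R_eta_ge_scaled_norm_power2)
qed

theorem lemma2p5:
  fixes \<alpha> \<beta> \<eta> :: real
  assumes "\<alpha> > \<beta>" and "\<beta> \<ge> 0" and "\<eta> = \<beta> / \<alpha>"
  shows "range (R_eta \<eta>) \<subseteq> {0..\<infinity>} \<and> coercive (R_eta \<eta>)"
proof
  have "\<eta> < 1" using assms by simp
  then show "coercive (R_eta \<eta>)" by (rule coercive_R_eta)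
  have "0 \<le> R_eta \<eta> x" for x
  proof -
    have "0 \<le> ereal ((1 - \<eta>) * (norm x)\<^sup>2)" using \<open>\<eta> < 1\<close> by simp
    also have "\<dots> \<le> R_eta \<eta> x" by (rule R_eta_ge_scaled_norm_power2)
    finally show ?thesis .
  qed
  then show "range (R_eta \<eta>) \<subseteq> {0..\<infinity>}" by auto
qed

end
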